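(* Let $\widetilde w_1=\frac{|\xi|^2-1}{\sqrt2\,\bar\xi}$, $\widetilde w_2=-\frac{\xi}{\bar\xi}$ for $\xi=x+iy\in\mathbb{C}\setminus\{0\}$ (the mixed Veronese solution of the $\mathbb{C}P^2$ sigma model: $(1,\widetilde w_1,\widetilde w_2)$ is a scalar multiple of $P_+f$ for the Veronese vector $f=(1,\sqrt2\,\xi,\xi^2)$). Then the eight real Weierstrass 1-forms $dX_1,\dots,dX_8$ of $(w_1,w_2)=(\widetilde w_1,\widetilde w_2)$ given in the context integrate, up to additive constants, to $$X_1=-X_7=\frac{\sqrt2\,x}{1+x^2+y^2},\quad X_2=X_5=\frac{\sqrt2\,y}{1+x^2+y^2},\quad X_3=\frac{X_4}{\sqrt3}=\frac{1}{1+x^2+y^2},\quad X_6=X_8=0 .$$ Hence the surface lies in a 3-dimensional subspace of $\mathbb{R}^8$, and in the coordinates $(X_1,X_2,X_3)$ it satisfies $$X_1^2+X_2^2+\Big(\sqrt2\,X_3-\frac1{\sqrt2}\Big)^2=\frac12,$$ the equation of an ellipsoid in $\mathbb{R}^3$ centered at $(0,0,\tfrac12)$.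
   Context: $\partial=\partial/\partial\xi$ (Wirtinger derivative), "c.c." denotes the complex conjugate of the preceding $[\dots]d\xi$ term, and $P_+f=\partial f-f\frac{f^\dagger\partial f}{f^\dagger f}$. For functions $w_1,w_2$ put $A=1+|w_1|^2+|w_2|^2$. The Weierstrass 1-forms (components of the generalized Weierstrass immersion into $su(3)\simeq\mathbb{R}^8$) are $dX_1=\frac{1}{2A^2}\big([(w_2^2-w_1^2)(\bar w_1\partial\bar w_2-\bar w_2\partial\bar w_1)-(\bar w_2^2-\bar w_1^2)(w_1\partial w_2-w_2\partial w_1)-w_2\partial\bar w_1+\bar w_2\partial w_1-w_1\partial\bar w_2+\bar w_1\partial w_2]d\xi+\text{c.c.}\big)$, $dX_2=\frac{i}{2A^2}\big([(w_1^2+w_2^2)(\bar w_2\partial\bar w_1-\bar w_1\partial\bar w_2)+(\bar w_1^2+\bar w_2^2)(w_2\partial w_1-w_1\partial w_2)+w_2\partial\bar w_1+\bar w_2\partial w_1-w_1\partial\bar w_2-\bar w_1\partial w_2]d\xi-\text{c.c.}\big)$, $dX_3=\frac{1}{2A^2}\big([w_2\partial\bar w_2-w_1\partial\bar w_1-\bar w_2\partial w_2+\bar w_1\partial w_1+2|w_1|^2(w_2\partial\bar w_2-\bar w_2\partial w_2)-2|w_2|^2(w_1\partial\bar w_1-\bar w_1\partial w_1)]d\xi+\text{c.c.}\big)$, $dX_4=\frac{\sqrt3}{2A^2}\big([w_1\partial\bar w_1+w_2\partial\bar w_2-\bar w_1\partial w_1-\bar w_2\partial w_2]d\xi+\text{c.c.}\big)$,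 $dX_5=-\frac{i}{2A^2}\big([(1+\bar w_1^2+|w_2|^2)\partial w_1+(1+w_1^2+|w_2|^2)\partial\bar w_1+(w_2\partial\bar w_2-\bar w_2\partial w_2)(w_1-\bar w_1)]d\xi-\text{c.c.}\big)$, $dX_6=-\frac{i}{2A^2}\big([(1+\bar w_2^2+|w_1|^2)\partial w_2+(1+w_2^2+|w_1|^2)\partial\bar w_2+(w_1\partial\bar w_1-\bar w_1\partial w_1)(w_2-\bar w_2)]d\xi-\text{c.c.}\big)$, $dX_7=\frac{1}{2A^2}\big([(1-w_1^2+|w_2|^2)\partial\bar w_1-(1-\bar w_1^2+|w_2|^2)\partial w_1+(\bar w_2\partial w_2-w_2\partial\bar w_2)(w_1+\bar w_1)]d\xi+\text{c.c.}\big)$, $dX_8=\frac{1}{2A^2}\big([(1-w_2^2+|w_1|^2)\partial\bar w_2-(1-\bar w_2^2+|w_1|^2)\partial w_2+(\bar w_1\partial w_1-w_1\partial\bar w_1)(w_2+\bar w_2)]d\xi+\text{c.c.}\big)$. *)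

theory Defs
  imports "HOL-Analysis.Analysis"
begin

text \<open>The Wirtinger derivative $\partial/\partial\xi = \frac12(\partial_x - i\,\partial_y)$; it is
  applied to functions that are real-differentiable but in general not holomorphic.\<close>

definition wirtinger :: "(complex \<Rightarrow> complex) \<Rightarrow> complex \<Rightarrow> complex" where
  "wirtinger f \<xi> =
     (frechet_derivative f (at \<xi>) 1 - \<i> * frechet_derivative f (at \<xi>) \<i>) / 2"

definition wirtinger_vec :: "(complex \<Rightarrow> complex ^ 'n) \<Rightarrow> complex \<Rightarrow> complex ^ 'n" where
  "wirtinger_vec f \<xi> = (\<chi> i. wirtinger (\<lambda>z. f z $ i) \<xi>)"

text \<open>\<open>dagger_mult f g\<close> is $f^\dagger g$, conjugate-linear in the first argument.\<close>

definition dagger_mult :: "complex ^ 'n \<Rightarrow> complex ^ 'n \<Rightarrow> complex" where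
  "dagger_mult f g = (\<Sum>i\<in>UNIV. cnj (f $ i) * g $ i)"

definition P_plus :: "(complex \<Rightarrow> complex ^ 'n) \<Rightarrow> complex \<Rightarrow> complex ^ 'n" where
  "P_plus f \<xi> = wirtinger_vec f \<xi>
     - (dagger_mult (f \<xi>) (wirtinger_vec f \<xi>) / dagger_mult (f \<xi>) (f \<xi>)) *s f \<xi>"

definition veronese :: "complex \<Rightarrow> complex ^ 3" where
  "veronese \<xi> = vector [1, complex_of_real (sqrt 2) * \<xi>, \<xi>\<^sup>2]"

definition mixed_w1 :: "complex \<Rightarrow> complex" where
  "mixed_w1 \<xi> = complex_of_real ((cmod \<xi>)\<^sup>2 - 1) / (complex_of_real (sqrt 2) * cnj \<xi>)"

definition mixed_w2 :: "complex \<Rightarrow> complex" where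
  "mixed_w2 \<xi> = - (\<xi> / cnj \<xi>)"

text \<open>The eight bracketed coefficients of $d\xi$ in the Weierstrass 1-forms. Below,
  \<open>a = w\<^sub>1\<close>, \<open>b = w\<^sub>2\<close>, \<open>a' = cnj w\<^sub>1\<close>, \<open>b' = cnj w\<^sub>2\<close>, \<open>na = |w\<^sub>1|^2\<close>,
  \<open>nb = |w\<^sub>2|^2\<close>, and \<open>da\<close>, \<open>db\<close>, \<open>da'\<close>, \<open>db'\<close> are the Wirtinger derivatives of
  \<open>w\<^sub>1\<close>, \<open>w\<^sub>2\<close>, \<open>cnj w\<^sub>1\<close>, \<open>cnj w\<^sub>2\<close>.\<close>

definition weierstrass_coeff ::
  "(complex \<Rightarrow> complex) \<Rightarrow> (complex \<Rightarrow> complex) \<Rightarrow> complex \<Rightarrow> complex ^ 8" where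
  "weierstrass_coeff w1 w2 \<xi> =
    (let a = w1 \<xi>; b = w2 \<xi>; a' = cnj a; b' = cnj b;
         na = complex_of_real ((cmod a)\<^sup>2); nb = complex_of_real ((cmod b)\<^sup>2);
         da = wirtinger w1 \<xi>; db = wirtinger w2 \<xi>;
         da' = wirtinger (\<lambda>z. cnj (w1 z)) \<xi>; db' = wirtinger (\<lambda>z. cnj (w2 z)) \<xi>
     in vector [
       (b\<^sup>2 - a\<^sup>2) * (a' * db' - b' * da') - (b'\<^sup>2 - a'\<^sup>2) * (a * db - b * da)
         - b * da' + b' * da - a * db' + a' * db,
       (a\<^sup>2 + b\<^sup>2) * (b' * da' - a' * db') + (a'\<^sup>2 + b'\<^sup>2) * (b * da - a * db)
         + b * da' + b' * da - a * db' - a' * db,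
       b * db' - a * da' - b' * db + a' * da
         + 2 * na * (b * db' - b' * db) - 2 * nb * (a * da' - a' * da),
       a * da' + b * db' - a' * da - b' * db,
       (1 + a'\<^sup>2 + nb) * da + (1 + a\<^sup>2 + nb) * da' + (b * db' - b' * db) * (a - a'),
       (1 + b'\<^sup>2 + na) * db + (1 + b\<^sup>2 + na) * db' + (a * da' - a' * da) * (b - b'),
       (1 - a\<^sup>2 + nb) * da' - (1 - a'\<^sup>2 + nb) * da + (b' * db - b * db') * (a + a'),
       (1 - b\<^sup>2 + na) * db' - (1 - b'\<^sup>2 + na) * db + (a' * da - a * da') * (b + b')])"

text \<open>The Weierstrass 1-forms at \<open>\<xi>\<close>, evaluated on a tangent vector \<open>h\<close>: the form
  $d\xi$ takes the value \<open>h\<close>, and the complex conjugate term takes the value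
  \<open>cnj (c $ k * h)\<close>. The values are real, since each prefactor matches the sign of its
  conjugate term.\<close>

definition weierstrass_form ::
  "(complex \<Rightarrow> complex) \<Rightarrow> (complex \<Rightarrow> complex) \<Rightarrow> complex \<Rightarrow> complex \<Rightarrow> complex ^ 8" where
  "weierstrass_form w1 w2 \<xi> h =
    (let c = weierstrass_coeff w1 w2 \<xi>;
         A = complex_of_real (1 + (cmod (w1 \<xi>))\<^sup>2 + (cmod (w2 \<xi>))\<^sup>2)
     in vector [
       1 / (2 * A\<^sup>2) * (c $ 1 * h + cnj (c $ 1 * h)),
       \<i> / (2 * A\<^sup>2) * (c $ 2 * h - cnj (c $ 2 * h)),
       1 / (2 * A\<^sup>2) * (c $ 3 * h + cnj (c $ 3 * h)),
       complex_of_real (sqrt 3) / (2 * A\<^sup>2) * (c $ 4 * h + cnj (c $ 4 * h)),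
       - (\<i> / (2 * A\<^sup>2)) * (c $ 5 * h - cnj (c $ 5 * h)),
       - (\<i> / (2 * A\<^sup>2)) * (c $ 6 * h - cnj (c $ 6 * h)),
       1 / (2 * A\<^sup>2) * (c $ 7 * h + cnj (c $ 7 * h)),
       1 / (2 * A\<^sup>2) * (c $ 8 * h + cnj (c $ 8 * h))])"

text \<open>\<open>X\<close> integrates the Weierstrass 1-forms of \<open>(w1, w2)\<close> on \<open>D\<close>. The components of \<open>X\<close> are
  embedded into the complex numbers only because \<open>weierstrass_form\<close> is complex-typed.\<close>

definition integrates_weierstrass ::
  "(complex \<Rightarrow> complex) \<Rightarrow> (complex \<Rightarrow> complex) \<Rightarrow> complex set \<Rightarrow> (complex \<Rightarrow> real ^ 8) \<Rightarrow> bool"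
where
  "integrates_weierstrass w1 w2 D X \<longleftrightarrow>
     (\<forall>\<xi>\<in>D. \<forall>k. ((\<lambda>z. complex_of_real (X z $ k)) has_derivative
                     (\<lambda>h. weierstrass_form w1 w2 \<xi> h $ k)) (at \<xi>))"

definition mixed_X :: "complex \<Rightarrow> real ^ 8" where
  "mixed_X \<xi> =
    (let x = Re \<xi>; y = Im \<xi>; r = 1 + x\<^sup>2 + y\<^sup>2
     in vector [sqrt 2 * x / r, sqrt 2 * y / r, 1 / r, sqrt 3 * (1 / r),
                sqrt 2 * y / r, 0, - (sqrt 2 * x / r), 0])"

text \<open>An ellipsoid is the image of the unit sphere under an invertible affine map; its center is
  the image of the origin.\<close>

definition ellipsoid_centered_at :: "'a::euclidean_space \<Rightarrow> 'a set \<Rightarrow> bool" where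
  "ellipsoid_centered_at c E \<longleftrightarrow>
     (\<exists>T :: 'a \<Rightarrow> 'a. linear T \<and> bij T \<and> E = (\<lambda>u. c + T u) ` sphere 0 1)"

end

theory Submission
  imports Defs
begin

text \<open>With $u = \sqrt2/2$ the functions are $w_1 = u(\xi - 1/\bar\xi)$ and $w_2 = -\xi/\bar\xi$, so each
  is rational in $\xi, \bar\xi$ and its Wirtinger derivative is the coefficient of $h$ in its real
  derivative. Writing $r = |\xi|^2$ one finds $A = (1+r)^2/(2r)$, and all Weierstrass coefficients are
  multiples of $K = (1+r)^2/r^2$; since $K/(2A^2) = 2/(1+r)^2$, the forms are the differentials
  of $\sqrt2\,x/(1+r)$, $\sqrt2\,y/(1+r)$ and $1/(1+r)$. Uniqueness of the primitive up to a
  constant is connectedness of the punctured plane. The surface is the image of its first three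
  coordinates under a linear section of the coordinate projection.\<close>

section \<open>Indices and components of eight-dimensional vectors\<close>

lemma exhaust_8:
  fixes k :: 8
  shows "k = 1 \<or> k = 2 \<or> k = 3 \<or> k = 4 \<or> k = 5 \<or> k = 6 \<or> k = 7 \<or> k = 8"
proof (induct k)
  case (of_int z)
  then have "0 \<le> z" and "z < 8" by simp_all
  then have "z = 0 \<or> z = 1 \<or> z = 2 \<or> z = 3 \<or> z = 4 \<or> z = 5 \<or> z = 6 \<or> z = 7" by arith
  \<comment> \<open>The representative \<open>0\<close> is the index \<open>8\<close>, since
    arithmetic in this type is modulo 8.\<close>
  then show ?case by auto
qed

lemma forall_8:
  "(\<forall>k::8. P k) \<longleftrightarrow> P 1 \<and> P 2 \<and> P 3 \<and> P 4 \<and> P 5 \<and> P 6 \<and> P 7 \<and> P 8"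
  by (metis exhaust_8)

lemma vector_8:
  fixes a1 a2 a3 a4 a5 a6 a7 a8 :: "'a::zero"
  shows "(vector [a1, a2, a3, a4, a5, a6, a7, a8] :: 'a ^ 8) $ 1 = a1"
    and "(vector [a1, a2, a3, a4, a5, a6, a7, a8] :: 'a ^ 8) $ 2 = a2"
    and "(vector [a1, a2, a3, a4, a5, a6, a7, a8] :: 'a ^ 8) $ 3 = a3"
    and "(vector [a1, a2, a3, a4, a5, a6, a7, a8] :: 'a ^ 8) $ 4 = a4"
    and "(vector [a1, a2, a3, a4, a5, a6, a7, a8] :: 'a ^ 8) $ 5 = a5"
    and "(vector [a1, a2, a3, a4, a5, a6, a7, a8] :: 'a ^ 8) $ 6 = a6"
    and "(vector [a1, a2, a3, a4, a5, a6, a7, a8] :: 'a ^ 8) $ 7 = a7"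
    and "(vector [a1, a2, a3, a4, a5, a6, a7, a8] :: 'a ^ 8) $ 8 = a8"
  unfolding vector_def by simp_all

section \<open>Wirtinger derivatives of the mixed solution\<close>

text \<open>Evaluating the real derivative at 1 and at the imaginary unit gives p + q and i(p - q);
  the Wirtinger combination of the two cancels q and leaves p. Derivatives are therefore kept in the
  shape \<open>p * h + q * cnj h\<close> throughout.\<close>

lemma wirtinger_eq:
  assumes "(f has_derivative (\<lambda>h. p * h + q * cnj h)) (at z)"
  shows "wirtinger f z = p"
  using frechet_derivative_at[OF assms, symmetric]
  by (simp add: wirtinger_def algebra_simps)

text \<open>Conjugating the values swaps the roles of the two coefficients, so one real derivative
  of f yields the Wirtinger derivatives of both f and its conjugate.\<close>

lemma wirtinger_cnj_eq:
  assumes "(f has_derivative (\<lambda>h. p * h + q * cnj h)) (at z)"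
  shows "wirtinger (\<lambda>z. cnj (f z)) z = cnj q"
proof (rule wirtinger_eq)
  show "((\<lambda>z. cnj (f z)) has_derivative (\<lambda>h. cnj q * h + cnj p * cnj h)) (at z)"
    using bounded_linear.has_derivative[OF bounded_linear_cnj assms] by (simp add: add.commute)
qed

text \<open>Replacing the squared modulus by \<open>z * cnj z\<close> removes \<open>cmod\<close>,
  so that the differentiation rules and field arithmetic apply.\<close>

lemma mixed_w1_eq:
  assumes "z \<noteq> 0"
  shows "mixed_w1 z = complex_of_real (sqrt 2) / 2 * (z - inverse (cnj z))"
proof -
  have "complex_of_real (sqrt 2) * complex_of_real (sqrt 2) = 2"
    by (simp flip: of_real_mult)
  then have "1 / complex_of_real (sqrt 2) = complex_of_real (sqrt 2) / 2"
    by (simp add: divide_simps)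
  moreover have "mixed_w1 z = (1 / complex_of_real (sqrt 2)) * ((z * cnj z - 1) / cnj z)"
    by (simp add: mixed_w1_def flip: complex_norm_square)
  moreover have "(z * cnj z - 1) / cnj z = z - inverse (cnj z)"
    using assms by (simp add: diff_divide_distrib inverse_eq_divide)
  ultimately show ?thesis by (simp only:)
qed

lemma has_derivative_inverse_cnj:
  assumes "z \<noteq> 0"
  shows "((\<lambda>z. inverse (cnj z)) has_derivative (\<lambda>h. - (cnj h / (cnj z)\<^sup>2))) (at z)"
proof -
  have "((\<lambda>z. inverse (cnj z)) has_derivative
      (\<lambda>h. - (inverse (cnj z) * cnj h * inverse (cnj z)))) (at z)"
    by (rule Deriv.has_derivative_inverse[OF _ bounded_linear_imp_has_derivative[OF bounded_linear_cnj]])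
      (simp add: assms)
  then show ?thesis
    by (simp add: power2_eq_square divide_inverse mult_ac)
qed

lemma mixed_w1_has_derivative:
  assumes "z \<noteq> 0"
  shows "(mixed_w1 has_derivative (\<lambda>h. complex_of_real (sqrt 2) / 2 * h +
    complex_of_real (sqrt 2) / (2 * (cnj z)\<^sup>2) * cnj h)) (at z)"
proof (rule has_derivative_transform_within_open)
  have "((\<lambda>z. complex_of_real (sqrt 2) / 2 * (z - inverse (cnj z))) has_derivative
      (\<lambda>h. complex_of_real (sqrt 2) / 2 * (h - - (cnj h / (cnj z)\<^sup>2)))) (at z)"
    by (intro has_derivative_mult_right has_derivative_diff has_derivative_ident
        has_derivative_inverse_cnj assms)
  then show "((\<lambda>z. complex_of_real (sqrt 2) / 2 * (z - inverse (cnj z))) has_derivative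
      (\<lambda>h. complex_of_real (sqrt 2) / 2 * h +
        complex_of_real (sqrt 2) / (2 * (cnj z)\<^sup>2) * cnj h)) (at z)"
    by (simp add: distrib_left)
  show "open (- {0::complex})" by auto
qed (use assms mixed_w1_eq in auto)

lemma mixed_w2_has_derivative:
  assumes "z \<noteq> 0"
  shows "(mixed_w2 has_derivative (\<lambda>h. - (1 / cnj z) * h + z / (cnj z)\<^sup>2 * cnj h)) (at z)"
proof -
  have "((\<lambda>z. - (z * inverse (cnj z))) has_derivative
      (\<lambda>h. - (z * - (cnj h / (cnj z)\<^sup>2) + h * inverse (cnj z)))) (at z)"
    by (intro has_derivative_minus has_derivative_mult has_derivative_ident
        has_derivative_inverse_cnj assms)
  then show ?thesis
    by (simp add: mixed_w2_def [abs_def] divide_inverse mult_ac)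
qed

lemma wirtinger_mixed:
  assumes "z \<noteq> 0"
  shows "wirtinger mixed_w1 z = complex_of_real (sqrt 2) / 2"
    and "wirtinger mixed_w2 z = - (1 / cnj z)"
    and "wirtinger (\<lambda>z. cnj (mixed_w1 z)) z = complex_of_real (sqrt 2) / (2 * z\<^sup>2)"
    and "wirtinger (\<lambda>z. cnj (mixed_w2 z)) z = cnj z / z\<^sup>2"
  using wirtinger_eq[OF mixed_w1_has_derivative[OF assms]]
    wirtinger_eq[OF mixed_w2_has_derivative[OF assms]]
    wirtinger_cnj_eq[OF mixed_w1_has_derivative[OF assms]]
    wirtinger_cnj_eq[OF mixed_w2_has_derivative[OF assms]]
  by simp_all

section \<open>Weierstrass coefficients and forms in closed form\<close>

text \<open>With r = |z|^2, the second function has modulus 1 and the first has squared modulus (r -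
  1)^2 / (2r), so the sum is 2 + (r - 1)^2 / (2r), a perfect square over 2r.\<close>

lemma mixed_norm_factor:
  assumes "z \<noteq> 0"
  shows "complex_of_real (1 + (cmod (mixed_w1 z))\<^sup>2 + (cmod (mixed_w2 z))\<^sup>2) =
    (1 + z * cnj z)\<^sup>2 / (2 * (z * cnj z))"
proof -
  let ?s = "complex_of_real (sqrt 2)"
  \<comment> \<open>The second equation catches the square of the root inside a longer right-nested
    product.\<close>
  have s: "?s * ?s = 2" "?s * (?s * x) = 2 * x" for x
    by (simp_all flip: of_real_mult mult.assoc)
  show ?thesis unfolding of_real_add complex_norm_square mixed_w1_eq[OF assms] mixed_w2_def
    using assms by (simp add: field_simps power2_eq_square s)
qed

text \<open>Substituting the rational expressions leaves \<open>K\<close> as a common factor of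
  every nonzero entry; it is displayed because it cancels against the squared norm factor in the
  forms.\<close>

lemma weierstrass_coeff_mixed:
  assumes "z \<noteq> 0"
  defines "s \<equiv> complex_of_real (sqrt 2)" and "w \<equiv> cnj z"
  defines "K \<equiv> ((1 + z * w) / (z * w))\<^sup>2"
  shows "weierstrass_coeff mixed_w1 mixed_w2 z = vector
    [s * K * (1 - w\<^sup>2) / 4, - (s * K * (1 + w\<^sup>2) / 4), - (K * w / 2), - (K * w / 2),
     s * K * (1 + w\<^sup>2) / 4, 0, - (s * K * (1 - w\<^sup>2) / 4), 0]"
proof -
  have s: "s * s = 2" "s * (s * x) = 2 * x" for x
    by (simp_all add: s_def flip: of_real_mult mult.assoc)
  have cs: "cnj s = s" "cnj w = z" by (simp_all add: s_def w_def)
  have w: "w \<noteq> 0" using assms by simp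
  \<comment> \<open>Comparing the two lists entry by entry leaves eight rational identities in
    \<open>z\<close>, \<open>w\<close> and \<open>s\<close>.\<close>
  show ?thesis
    unfolding weierstrass_coeff_def Let_def complex_norm_square wirtinger_mixed[OF assms(1)]
    unfolding mixed_w1_eq[OF assms(1)] mixed_w2_def s_def[symmetric] w_def[symmetric]
      complex_cnj_mult complex_cnj_inverse complex_cnj_divide complex_cnj_minus complex_cnj_diff
      complex_cnj_one complex_cnj_numeral cs K_def inverse_eq_divide
    using assms(1) w
    by (intro arg_cong[where f=vector] arg_cong2[where f=Cons] refl)
      (simp_all add: field_simps power2_eq_square s)
qed

lemma one_plus_mult_cnj_neq_0: "1 + z * cnj z \<noteq> 0"
proof -
  have "1 + z * cnj z = complex_of_real (1 + (cmod z)\<^sup>2)"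
    by (simp flip: complex_norm_square)
  moreover have "1 + (cmod z)\<^sup>2 \<noteq> 0" by (smt (verit) zero_le_power2)
  ultimately show ?thesis by (metis of_real_eq_0_iff)
qed

text \<open>The prefactor turns \<open>K\<close> into 2 / \<open>D\<close>. The abbreviations
  \<open>d1\<close>, \<open>d2\<close>, \<open>d3\<close> have the shape in which the derivatives of
  the first three coordinates are computed below.\<close>

lemma weierstrass_form_mixed:
  assumes "z \<noteq> 0"
  defines "s \<equiv> complex_of_real (sqrt 2)" and "D \<equiv> (1 + z * cnj z)\<^sup>2"
  defines "d1 \<equiv> \<lambda>h. s * ((1 - (cnj z)\<^sup>2) * h + (1 - z\<^sup>2) * cnj h) / (2 * D)"
    and "d2 \<equiv> \<lambda>h. - \<i> * s * ((1 + (cnj z)\<^sup>2) * h - (1 + z\<^sup>2) * cnj h) / (2 * D)"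
    and "d3 \<equiv> \<lambda>h. - ((cnj z * h + z * cnj h) / D)"
  shows "weierstrass_form mixed_w1 mixed_w2 z h =
    vector [d1 h, d2 h, d3 h, complex_of_real (sqrt 3) * d3 h, d2 h, 0, - d1 h, 0]"
proof -
  \<comment> \<open>Treating \<open>r\<close> and \<open>d\<close> as atoms lets denominators be
    cleared without expanding them.\<close>
  define r where "r = z * cnj z"
  define d where "d = 1 + r"
  have nz: "r \<noteq> 0" "d \<noteq> 0"
    using assms(1) one_plus_mult_cnj_neq_0 by (simp_all add: r_def d_def)
  have cs: "cnj s = s" "cnj r = r" "cnj d = d"
    by (simp_all add: s_def d_def r_def)
  show ?thesis
    unfolding weierstrass_form_def Let_def mixed_norm_factor[OF assms(1)]
      weierstrass_coeff_mixed[OF assms(1), folded s_def] vector_8 d1_def d2_def d3_def D_def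
      r_def[symmetric] d_def[symmetric]
    using nz
    by (intro arg_cong[where f=vector] arg_cong2[where f=Cons] refl)
      (simp_all add: cs field_simps power2_eq_square)
qed

section \<open>Differentials of the surface coordinates\<close>

lemma has_derivative_inverse_one_plus_mult_cnj:
  "((\<lambda>z. inverse (1 + z * cnj z)) has_derivative
    (\<lambda>h. - ((cnj z * h + z * cnj h) / (1 + z * cnj z)\<^sup>2))) (at z)"
proof -
  have "((\<lambda>z. 1 + z * cnj z) has_derivative (\<lambda>h. 0 + (z * cnj h + h * cnj z))) (at z)"
    by (intro has_derivative_add has_derivative_const has_derivative_mult has_derivative_ident
        bounded_linear_imp_has_derivative bounded_linear_cnj)
  from Deriv.has_derivative_inverse[OF one_plus_mult_cnj_neq_0 this]
  show ?thesis
    by (rule has_derivative_eq_rhs) (simp add: fun_eq_iff power2_eq_square divide_inverse ac_simps)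
qed

lemma one_plus_mult_cnj: "1 + z * cnj z = complex_of_real (1 + (Re z)\<^sup>2 + (Im z)\<^sup>2)"
  by (simp only: complex_mult_cnj of_real_add of_real_1 add.assoc)

lemma mixed_X_nth:
  defines "r \<equiv> \<lambda>z. 1 + (Re z)\<^sup>2 + (Im z)\<^sup>2"
  shows "mixed_X z $ 1 = sqrt 2 * Re z / r z" "mixed_X z $ 2 = sqrt 2 * Im z / r z"
    "mixed_X z $ 3 = 1 / r z" "mixed_X z $ 4 = sqrt 3 * mixed_X z $ 3"
    "mixed_X z $ 5 = mixed_X z $ 2" "mixed_X z $ 6 = 0" "mixed_X z $ 7 = - mixed_X z $ 1"
    "mixed_X z $ 8 = 0"
  unfolding r_def mixed_X_def Let_def vector_8 by (rule refl)+

text \<open>Writing the real part as half of \<open>z + cnj z\<close> makes the coordinate a product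
  whose derivative comes out in \<open>h\<close> and \<open>cnj h\<close>.\<close>

lemma mixed_X_1:
  "complex_of_real (mixed_X z $ 1) =
    complex_of_real (sqrt 2) / 2 * ((z + cnj z) * inverse (1 + z * cnj z))"
  unfolding mixed_X_nth one_plus_mult_cnj complex_add_cnj
  by (simp only: of_real_mult of_real_divide divide_inverse) simp

lemma mixed_X_2:
  "complex_of_real (mixed_X z $ 2) =
    - (\<i> * complex_of_real (sqrt 2) / 2) * ((z - cnj z) * inverse (1 + z * cnj z))"
  unfolding mixed_X_nth one_plus_mult_cnj complex_diff_cnj
  by (simp only: of_real_mult of_real_divide divide_inverse) (simp add: mult_ac)

lemma mixed_X_3: "complex_of_real (mixed_X z $ 3) = inverse (1 + z * cnj z)"
  unfolding mixed_X_nth one_plus_mult_cnj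
  by (simp only: of_real_divide of_real_1 inverse_eq_divide)

text \<open>By the product rule the coefficient of \<open>h\<close> in the numerator is 1 + z cnj z
  - (z + cnj z) cnj z = 1 - (cnj z)^2, and that of \<open>cnj h\<close> is its conjugate.\<close>

lemma has_derivative_mixed_X_1:
  "((\<lambda>z. complex_of_real (mixed_X z $ 1)) has_derivative (\<lambda>h. complex_of_real (sqrt 2) *
    ((1 - (cnj z)\<^sup>2) * h + (1 - z\<^sup>2) * cnj h) / (2 * (1 + z * cnj z)\<^sup>2))) (at z)"
  unfolding mixed_X_1
  using one_plus_mult_cnj_neq_0[of z]
  by (intro has_derivative_eq_rhs[OF has_derivative_mult_right[OF has_derivative_mult[OF
        has_derivative_add[OF has_derivative_ident
          bounded_linear_imp_has_derivative[OF bounded_linear_cnj]]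
        has_derivative_inverse_one_plus_mult_cnj]]])
    (simp add: fun_eq_iff divide_simps, simp add: power2_eq_square algebra_simps)

lemma has_derivative_mixed_X_2:
  "((\<lambda>z. complex_of_real (mixed_X z $ 2)) has_derivative (\<lambda>h. - \<i> * complex_of_real (sqrt 2) *
    ((1 + (cnj z)\<^sup>2) * h - (1 + z\<^sup>2) * cnj h) / (2 * (1 + z * cnj z)\<^sup>2))) (at z)"
  unfolding mixed_X_2
  using one_plus_mult_cnj_neq_0[of z]
  by (intro has_derivative_eq_rhs[OF has_derivative_mult_right[OF has_derivative_mult[OF
        has_derivative_diff[OF has_derivative_ident
          bounded_linear_imp_has_derivative[OF bounded_linear_cnj]]
        has_derivative_inverse_one_plus_mult_cnj]]])
    (simp add: fun_eq_iff divide_simps, simp add: power2_eq_square algebra_simps)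

text \<open>Three derivatives suffice: component 4 is a multiple of 3, component 5 equals 2,
  component 7 is the negative of 1, and components 6 and 8 are constant.\<close>

lemma mixed_X_integrates: "integrates_weierstrass mixed_w1 mixed_w2 (- {0}) mixed_X"
proof -
  have "((\<lambda>z. complex_of_real (mixed_X z $ k)) has_derivative
      (\<lambda>h. weierstrass_form mixed_w1 mixed_w2 z h $ k)) (at z)" if "z \<noteq> 0" for z k
    using exhaust_8[of k] has_derivative_mixed_X_1[of z] has_derivative_mixed_X_2[of z]
      has_derivative_inverse_one_plus_mult_cnj[of z, folded mixed_X_3]
      has_derivative_mult_right[OF has_derivative_inverse_one_plus_mult_cnj[of z, folded mixed_X_3],
        of "complex_of_real (sqrt 3)"]
      has_derivative_minus[OF has_derivative_mixed_X_1[of z]]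
    by (elim disjE)
      (simp_all only: weierstrass_form_mixed[OF that] vector_8 mixed_X_nth(4-) of_real_mult
        of_real_minus of_real_0 has_derivative_const)
  then show ?thesis
    by (simp add: integrates_weierstrass_def)
qed

section \<open>Primitives are unique up to a constant\<close>

text \<open>The difference of two primitives has zero derivative on a connected open set, hence is
  constant there; adding a constant changes no derivative.\<close>

lemma integrates_weierstrass_iff:
  fixes X X0 :: "complex \<Rightarrow> real ^ 8"
  assumes X0: "integrates_weierstrass w1 w2 D X0" and D: "open D" "connected D"
  shows "integrates_weierstrass w1 w2 D X \<longleftrightarrow> (\<exists>C. \<forall>\<xi>\<in>D. X \<xi> = X0 \<xi> + C)"
proof
  assume X: "integrates_weierstrass w1 w2 D X"
  have const: "X x $ k - X0 x $ k = X y $ k - X0 y $ k" if "x \<in> D" "y \<in> D" for x y k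
  proof -
    have "complex_of_real (X x $ k) - complex_of_real (X0 x $ k) =
        complex_of_real (X y $ k) - complex_of_real (X0 y $ k)"
    proof (rule has_derivative_zero_unique_connected[OF D _ that])
      fix z assume "z \<in> D"
      then have "((\<lambda>z. complex_of_real (X z $ k) - complex_of_real (X0 z $ k)) has_derivative
          (\<lambda>h. weierstrass_form w1 w2 z h $ k - weierstrass_form w1 w2 z h $ k)) (at z)"
        using X X0 unfolding integrates_weierstrass_def by (intro has_derivative_diff) auto
      then show "((\<lambda>z. complex_of_real (X z $ k) - complex_of_real (X0 z $ k)) has_derivative
          (\<lambda>h. 0)) (at z)"
        by simp
    qed
    then show ?thesis by (simp flip: of_real_diff)
  qed
  show "\<exists>C. \<forall>\<xi>\<in>D. X \<xi> = X0 \<xi> + C"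
  \<comment> \<open>A base point \<open>y\<close> of the domain fixes the constant as
    \<open>X y - X0 y\<close>; on the empty domain any constant serves.\<close>
  proof (cases "D = {}")
    case False
    then obtain y where "y \<in> D" by blast
    have "X \<xi> = X0 \<xi> + (X y - X0 y)" if "\<xi> \<in> D" for \<xi>
      using const[OF that \<open>y \<in> D\<close>]
      by (simp only: vec_eq_iff vector_add_component vector_minus_component) (simp add: algebra_simps)
    then show ?thesis by blast
  qed auto
next
  assume "\<exists>C. \<forall>\<xi>\<in>D. X \<xi> = X0 \<xi> + C"
  then obtain C where C: "\<And>\<xi>. \<xi> \<in> D \<Longrightarrow> X \<xi> = X0 \<xi> + C" by blast
  have "((\<lambda>z. complex_of_real (X z $ k)) has_derivative
      (\<lambda>h. weierstrass_form w1 w2 z h $ k)) (at z)" if z: "z \<in> D" for z k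
  \<comment> \<open>\<open>X\<close> is known to equal \<open>X0 + C\<close> only on
    \<open>D\<close>, so openness is what transfers the derivative.\<close>
  proof (rule has_derivative_transform_within_open[OF _ D(1) z])
    show "((\<lambda>z. complex_of_real (X0 z $ k) + complex_of_real (C $ k)) has_derivative
        (\<lambda>h. weierstrass_form w1 w2 z h $ k)) (at z)"
      using X0 z unfolding integrates_weierstrass_def
      by (intro has_derivative_add_const) auto
  qed (simp add: C)
  then show "integrates_weierstrass w1 w2 D X"
    by (simp add: integrates_weierstrass_def)
qed

section \<open>Relation to the Veronese vector\<close>

lemma P_plus_veronese:
  "P_plus veronese z = vector [- (2 * cnj z / (1 + z * cnj z)),
     complex_of_real (sqrt 2) * (1 - z * cnj z) / (1 + z * cnj z), 2 * z / (1 + z * cnj z)]"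
proof -
  define s where "s = complex_of_real (sqrt 2)"
  have s: "s * s = 2" "s * (s * x) = 2 * x" for x
    by (simp_all add: s_def flip: of_real_mult mult.assoc)
  have cs: "cnj s = s" by (simp add: s_def)
  have nz: "1 + z * cnj z \<noteq> 0" by (rule one_plus_mult_cnj_neq_0)
  have "wirtinger (\<lambda>z. 1) z = 0"
    by (rule wirtinger_eq[where q = 0]) simp
  moreover have "wirtinger (\<lambda>z. s * z) z = s"
    by (rule wirtinger_eq[where q = 0]) (simp add: bounded_linear_imp_has_derivative bounded_linear_mult_right)
  moreover have "wirtinger (\<lambda>z. z\<^sup>2) z = 2 * z"
    by (rule wirtinger_eq[where q = 0])
      (rule has_derivative_eq_rhs[OF has_derivative_power[OF has_derivative_ident]], simp add: fun_eq_iff)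
  ultimately have dv: "wirtinger_vec veronese z = vector [0, s, 2 * z]"
    by (simp add: wirtinger_vec_def veronese_def vec_eq_iff forall_3 s_def)
  have v: "veronese z = vector [1, s * z, z\<^sup>2]" by (simp add: veronese_def s_def)
  \<comment> \<open>The factor sqrt 2 in the Veronese vector makes 1 + 2r + r^2, with r = |z|^2, a
    perfect square.\<close>
  have norm: "dagger_mult (veronese z) (veronese z) = (1 + z * cnj z)\<^sup>2"
    by (simp add: dagger_mult_def sum_3 v cs power2_eq_square algebra_simps s)
  have inner: "dagger_mult (veronese z) (wirtinger_vec veronese z) = 2 * cnj z * (1 + z * cnj z)"
    by (simp add: dagger_mult_def sum_3 v dv cs power2_eq_square algebra_simps s)
  have "P_plus veronese z = vector [0, s, 2 * z] - (2 * cnj z / (1 + z * cnj z)) *s vector [1, s * z, z\<^sup>2]"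
    using nz unfolding P_plus_def norm inner unfolding dv v
    by (simp add: power2_eq_square)
  also have "\<dots> = vector [- (2 * cnj z / (1 + z * cnj z)), s * (1 - z * cnj z) / (1 + z * cnj z),
      2 * z / (1 + z * cnj z)]"
    using nz by (simp add: vec_eq_iff forall_3 divide_simps) (simp add: power2_eq_square algebra_simps)
  finally show ?thesis by (simp add: s_def)
qed

text \<open>The scalar is the reciprocal of the first component of \<open>P_plus veronese z\<close>,
  which is nonzero away from the origin.\<close>

lemma mixed_eq_scaled_P_plus:
  assumes "z \<noteq> 0"
  shows "vector [1, mixed_w1 z, mixed_w2 z] = (- ((1 + z * cnj z) / (2 * cnj z))) *s P_plus veronese z"
  using assms one_plus_mult_cnj_neq_0[of z]
  by (simp add: vec_eq_iff forall_3 P_plus_veronese mixed_w1_eq mixed_w2_def divide_simps)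
    (simp add: power2_eq_square algebra_simps)

section \<open>The three-dimensional subspace and the ellipsoid\<close>

text \<open>This encodes the linear relations among the eight coordinates; its range is the subspace
  containing the surface.\<close>

definition mixed_span_map :: "real ^ 3 \<Rightarrow> real ^ 8" where
  "mixed_span_map p = vector [p $ 1, p $ 2, p $ 3, sqrt 3 * p $ 3, p $ 2, 0, - p $ 1, 0]"

text \<open>The coordinate projection is a left inverse of \<open>mixed_span_map\<close>. This makes
  the map injective, which gives the dimension, and makes the projection bijective on the
  range.\<close>

lemma mixed_X_3_dimensional:
  "\<exists>S :: (real ^ 8) set. subspace S \<and> dim S = 3 \<and> range mixed_X \<subseteq> S \<and>
     bij_betw (\<lambda>v. vector [v $ 1, v $ 2, v $ 3] :: real ^ 3) S UNIV"
proof (intro exI conjI)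
  let ?pr = "\<lambda>v :: real ^ 8. vector [v $ 1, v $ 2, v $ 3] :: real ^ 3"
  have lin: "linear mixed_span_map"
    by (rule linearI) (simp_all add: mixed_span_map_def vec_eq_iff forall_8 vector_8 algebra_simps)
  have pr: "?pr (mixed_span_map p) = p" for p
    by (simp add: mixed_span_map_def vec_eq_iff forall_3 vector_8)
  have inj: "inj mixed_span_map" by (rule inj_on_inverseI[of _ ?pr]) (rule pr)
  show "subspace (range mixed_span_map)"
    using lin by (simp add: linear_subspace_image)
  show "dim (range mixed_span_map) = 3"
    using dim_image_eq[OF lin, of UNIV] inj by simp
  have "mixed_X z = mixed_span_map (?pr (mixed_X z))" for z
    by (simp add: mixed_span_map_def vec_eq_iff forall_8 vector_8 mixed_X_nth(4-))
  then show "range mixed_X \<subseteq> range mixed_span_map" by blast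
  show "bij_betw ?pr (range mixed_span_map) UNIV"
    by (rule bij_betw_byWitness[where f' = mixed_span_map]) (auto simp: pr)
qed

text \<open>With r = 1 + x^2 + y^2 the quadratic terms add up to 2(x^2 + y^2 + 1) / r^2 = 2 / r,
  which cancels the cross term of the completed square.\<close>

lemma mixed_X_ellipsoid_equation:
  "(mixed_X z $ 1)\<^sup>2 + (mixed_X z $ 2)\<^sup>2 + (sqrt 2 * mixed_X z $ 3 - 1 / sqrt 2)\<^sup>2 = 1 / 2"
proof -
  define r where "r = 1 + (Re z)\<^sup>2 + (Im z)\<^sup>2"
  have r: "r \<noteq> 0" unfolding r_def by (smt (verit) zero_le_power2)
  have sq: "(sqrt 2 * x - 1 / sqrt 2)\<^sup>2 = 2 * x\<^sup>2 - 2 * x + 1 / 2" for x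
    by (simp add: power2_diff power_mult_distrib power_divide)
  have "(mixed_X z $ 1)\<^sup>2 + (mixed_X z $ 2)\<^sup>2 + (sqrt 2 * mixed_X z $ 3 - 1 / sqrt 2)\<^sup>2 =
      2 * ((Re z)\<^sup>2 + (Im z)\<^sup>2 + 1) / r\<^sup>2 - 2 / r + 1 / 2"
    unfolding sq unfolding mixed_X_nth r_def[symmetric]
    by (simp add: power_divide power_mult_distrib add_divide_distrib)
  also have "(Re z)\<^sup>2 + (Im z)\<^sup>2 + 1 = r" by (simp add: r_def)
  finally show ?thesis using r by (simp add: power2_eq_square)
qed

text \<open>The semi-axes are 1 / sqrt 2, 1 / sqrt 2 and 1 / 2, so \<open>?T\<close> is the diagonal
  map with these entries.\<close>

lemma ellipsoid_centered_at_half: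
  "ellipsoid_centered_at (vector [0, 0, 1 / 2])
     {p :: real ^ 3. (p $ 1)\<^sup>2 + (p $ 2)\<^sup>2 + (sqrt 2 * p $ 3 - 1 / sqrt 2)\<^sup>2 = 1 / 2}"
  unfolding ellipsoid_centered_at_def
proof (intro exI conjI)
  let ?T = "\<lambda>u :: real ^ 3. vector [u $ 1 / sqrt 2, u $ 2 / sqrt 2, u $ 3 / 2] :: real ^ 3"
  let ?T' = "\<lambda>u :: real ^ 3. vector [sqrt 2 * u $ 1, sqrt 2 * u $ 2, 2 * u $ 3] :: real ^ 3"
  let ?c = "vector [0, 0, 1 / 2] :: real ^ 3"
  let ?E = "{p :: real ^ 3. (p $ 1)\<^sup>2 + (p $ 2)\<^sup>2 + (sqrt 2 * p $ 3 - 1 / sqrt 2)\<^sup>2 = 1 / 2}"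
  have inv: "?T' (?T u) = u" "?T (?T' u) = u" for u
    by (simp_all add: vec_eq_iff forall_3)
  show "linear ?T"
    by (rule linearI) (simp_all add: vec_eq_iff forall_3 add_divide_distrib)
  show "bij ?T"
    by (rule o_bij[where g = ?T']) (simp_all only: fun_eq_iff comp_def id_apply inv simp_thms)
  \<comment> \<open>The shift by the center cancels the constant, because sqrt 2 / 2 = 1 / sqrt
    2.\<close>
  have *: "(sqrt 2 * (1 / 2 + x / 2) - 1 / sqrt 2)\<^sup>2 = x\<^sup>2 / 2" for x
  proof -
    have "sqrt 2 * (1 / 2 + x / 2) - 1 / sqrt 2 = x / sqrt 2"
      by (simp add: field_simps)
    then show ?thesis by (simp add: power_divide)
  qed
  have sph: "u \<in> sphere 0 1 \<longleftrightarrow> (u $ 1)\<^sup>2 + (u $ 2)\<^sup>2 + (u $ 3)\<^sup>2 = 1" for u :: "real ^ 3"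
    by (simp add: norm_eq_1 inner_vec_def sum_3 power2_eq_square)
  have "?c + ?T u \<in> ?E \<longleftrightarrow> u \<in> sphere 0 1" for u
    by (simp only: sph) (simp add: * power_divide)
  \<comment> \<open>Once the sphere is the preimage of \<open>?E\<close>, surjectivity of the affine
    map turns this into the required image.\<close>
  then have "sphere 0 1 = (\<lambda>u. ?c + ?T u) -` ?E" by blast
  moreover have "surj (\<lambda>u. ?c + ?T u)"
    by (rule surjI[of _ "\<lambda>p. ?T' (p - ?c)"]) (simp only: inv, simp)
  ultimately show "?E = (\<lambda>u. ?c + ?T u) ` sphere 0 1"
    by (simp only: surj_image_vimage_eq)
qed

theorem mainTheorem4:
  shows "(\<forall>\<xi>. \<xi> \<noteq> 0 \<longrightarrow>
            (\<exists>c::complex. c \<noteq> 0 \<and>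
               (vector [1, mixed_w1 \<xi>, mixed_w2 \<xi>] :: complex ^ 3) = c *s P_plus veronese \<xi>))
       \<and> (\<forall>X :: complex \<Rightarrow> real ^ 8.
            integrates_weierstrass mixed_w1 mixed_w2 (- {0}) X \<longleftrightarrow>
            (\<exists>C. \<forall>\<xi>. \<xi> \<noteq> 0 \<longrightarrow> X \<xi> = mixed_X \<xi> + C))
       \<and> (\<exists>S :: (real ^ 8) set. subspace S \<and> dim S = 3 \<and> mixed_X ` (- {0}) \<subseteq> S \<and>
            bij_betw (\<lambda>v. vector [v $ 1, v $ 2, v $ 3] :: real ^ 3) S UNIV)
       \<and> (\<forall>\<xi>. \<xi> \<noteq> 0 \<longrightarrow>
            (mixed_X \<xi> $ 1)\<^sup>2 + (mixed_X \<xi> $ 2)\<^sup>2 + (sqrt 2 * mixed_X \<xi> $ 3 - 1 / sqrt 2)\<^sup>2 = 1 / 2)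
       \<and> ellipsoid_centered_at (vector [0, 0, 1 / 2])
            {p :: real ^ 3. (p $ 1)\<^sup>2 + (p $ 2)\<^sup>2 + (sqrt 2 * p $ 3 - 1 / sqrt 2)\<^sup>2 = 1 / 2}"
proof (intro conjI)
  show "\<forall>\<xi>. \<xi> \<noteq> 0 \<longrightarrow> (\<exists>c::complex. c \<noteq> 0 \<and>
      (vector [1, mixed_w1 \<xi>, mixed_w2 \<xi>] :: complex ^ 3) = c *s P_plus veronese \<xi>)"
    using mixed_eq_scaled_P_plus one_plus_mult_cnj_neq_0
    by (metis complex_cnj_zero_iff divide_eq_0_iff mult_eq_0_iff neg_equal_0_iff_equal zero_neq_numeral)
  \<comment> \<open>Removing a point keeps the plane connected because its real dimension is at
    least 2.\<close>
  have "connected (- {0 :: complex})" by (rule connected_punctured_universe) simp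
  from integrates_weierstrass_iff[OF mixed_X_integrates _ this]
  show "\<forall>X. integrates_weierstrass mixed_w1 mixed_w2 (- {0}) X \<longleftrightarrow>
      (\<exists>C. \<forall>\<xi>. \<xi> \<noteq> 0 \<longrightarrow> X \<xi> = mixed_X \<xi> + C)"
    by (simp add: Ball_def open_Compl)
  show "\<exists>S :: (real ^ 8) set. subspace S \<and> dim S = 3 \<and> mixed_X ` (- {0}) \<subseteq> S \<and>
      bij_betw (\<lambda>v. vector [v $ 1, v $ 2, v $ 3] :: real ^ 3) S UNIV"
    using mixed_X_3_dimensional by (meson image_mono subset_UNIV subset_trans)
qed (use mixed_X_ellipsoid_equation ellipsoid_centered_at_half in auto)

end
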